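(* Let $X$ be a compact metric space, $\mu$ a probability measure defined on the Borel subsets of $X$ and $\mathcal{U}$ a non-principal ultrafilter on $\mathbb{N}$. Consider a measurable map $T: X \to X$ and a measurable bounded function $\varphi: X \to \mathbb{R}$. Then there exists a $\widehat\mu_{\mathcal{U}}$-integrable map $\widehat\varphi_{\mathcal{U}}: \widehat X \to \mathbb{R}$ satisfying: (1) $\mathcal{U}\text{-}\lim_n \frac1n \sum_{j=0}^{n-1}\varphi\circ T^j(x) = \widehat\varphi_{\mathcal{U}}\circ\iota(x)$ for every $x\in X$; (2) $\widehat\varphi_{\mathcal{U}}\circ\iota(T(x)) = \widehat\varphi_{\mathcal{U}}\circ\iota(x)$ for every $x\in X$; (3) $\mathcal{U}\text{-}\lim_n \frac1n\sum_{j=0}^{n-1}\int_X \varphi\circ T^j\, d\mu = \int_{\widehat X}\widehat\varphi_{\mathcal{U}}\, d\widehat\mu_{\mathcal{U}}$.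
   Context: Ultralimits: a sequence $(a_n)$ in a compact Hausdorff space has $\mathcal{U}\text{-}\lim_n a_n=\ell$ if $\{n\in\mathbb{N} : a_n\in V\}\in\mathcal{U}$ for every neighbourhood $V$ of $\ell$; the limit exists and is unique. For real sequences the $\mathcal{U}$-limit is taken in $[-\infty,+\infty]$ (and is finite for bounded sequences). Ultrapower: $\widehat X = X^{\mathbb{N}}/\sim$, where $(a_n)\sim(b_n)$ iff $\{n : a_n=b_n\}\in\mathcal{U}$; $[x_n]$ denotes the class of $(x_n)_{n\in\mathbb{N}}$. The inclusion $\iota:X\to\widehat X$ sends $x$ to the class of the constant sequence equal to $x$. Ultrapower measure: let $\mathcal{B}$ be the Borel $\sigma$-algebra of $X$. For a sequence $(A_n)$ of subsets of $X$, the UP-set $\left(\prod_n A_n\right)/\sim$ is the set of all $[x_n]\in\widehat X$ with $\{n : x_n\in A_n\}\in\mathcal{U}$. Let $\widehat{\mathcal{B}}$ be the algebra of UP-sets with all $A_n\in\mathcal{B}$, and define $\widehat\mu_{\mathcal{U}}\left(\left(\prod_n A_n\right)/\sim\right)=\mathcal{U}\text{-}\lim_n\mu(A_n)$ (well defined and finitely additive; it satisfies the countable additivity compatibility condition on $\widehat{\mathcal{B}}$). Its Carathéodory extension, still denoted $\widehat\mu_{\mathcal{U}}$, is a complete probability measure on a $\sigma$-algebra $L(\widehat{\mathcal{B}})\supset\widehat{\mathcal{B}}$ (the sets measurable for the outer measure induced by $\widehat\mu_{\mathcal{U}}$ on $\widehat{\mathcal{B}}$). Measurability and integrability on $\widehat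 X$ refer to $(L(\widehat{\mathcal{B}}),\widehat\mu_{\mathcal{U}})$. *)

theory Defs
  imports "HOL-Probability.Probability_Measure"
begin

(* An ultrafilter on 'i is an 'i filter; "A belongs to the ultrafilter" is
   "eventually (\<lambda>i. i \<in> A) U", and an ultralimit "U-lim f = l" is (f \<longlongrightarrow> l) U. *)

definition ultrafilter :: "'i filter \<Rightarrow> bool" where
  "ultrafilter U \<longleftrightarrow>
     U \<noteq> bot \<and> (\<forall>P. eventually P U \<or> eventually (\<lambda>i. \<not> P i) U)"

definition nonprincipal_ultrafilter :: "'i filter \<Rightarrow> bool" where
  "nonprincipal_ultrafilter U \<longleftrightarrow> ultrafilter U \<and> (\<forall>i. U \<noteq> principal {i})"

definition ultra_rel :: "nat filter \<Rightarrow> ((nat \<Rightarrow> 'a) \<times> (nat \<Rightarrow> 'a)) set" where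
  "ultra_rel U = {(a, b). eventually (\<lambda>n. a n = b n) U}"

definition ultra_class :: "nat filter \<Rightarrow> (nat \<Rightarrow> 'a) \<Rightarrow> (nat \<Rightarrow> 'a) set" where
  "ultra_class U x = ultra_rel U `` {x}"

definition ultrapower :: "nat filter \<Rightarrow> (nat \<Rightarrow> 'a) set set" where
  "ultrapower U = UNIV // ultra_rel U"

definition ultra_incl :: "nat filter \<Rightarrow> 'a \<Rightarrow> (nat \<Rightarrow> 'a) set" where
  "ultra_incl U x = ultra_class U (\<lambda>_. x)"

definition up_set :: "nat filter \<Rightarrow> (nat \<Rightarrow> 'a set) \<Rightarrow> (nat \<Rightarrow> 'a) set set" where
  "up_set U A = {ultra_class U x | x. eventually (\<lambda>n. x n \<in> A n) U}"

definition up_algebra :: "nat filter \<Rightarrow> 'a measure \<Rightarrow> (nat \<Rightarrow> 'a) set set set" where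
  "up_algebra U M = {up_set U A | A. range A \<subseteq> sets M}"

(* The value does not depend on the sequence A representing S: see up_premeasure_up_set. *)
definition up_premeasure :: "nat filter \<Rightarrow> 'a measure \<Rightarrow> (nat \<Rightarrow> 'a) set set \<Rightarrow> ennreal" where
  "up_premeasure U M S =
     (THE c. \<exists>A. range A \<subseteq> sets M \<and> S = up_set U A \<and> ((\<lambda>n. emeasure M (A n)) \<longlongrightarrow> c) U)"

definition up_outer_measure :: "nat filter \<Rightarrow> 'a measure \<Rightarrow> (nat \<Rightarrow> 'a) set set \<Rightarrow> ennreal" where
  "up_outer_measure U M = outer_measure (up_algebra U M) (up_premeasure U M)"

(* That measure_of does not degenerate here is shown in sets_up_measure and emeasure_up_measure. *)
definition up_measure :: "nat filter \<Rightarrow> 'a measure \<Rightarrow> (nat \<Rightarrow> 'a) set measure" where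
  "up_measure U M =
     measure_of (ultrapower U)
       (lambda_system (ultrapower U) (Pow (ultrapower U)) (up_outer_measure U M))
       (up_outer_measure U M)"


lemma ultra_class_eq_iff:
  "ultra_class U x = ultra_class U y \<longleftrightarrow> eventually (\<lambda>n. x n = y n) U"
proof
  assume "ultra_class U x = ultra_class U y"
  moreover have "y \<in> ultra_class U y"
    by (simp add: ultra_class_def ultra_rel_def)
  ultimately have "y \<in> ultra_class U x" by simp
  then show "eventually (\<lambda>n. x n = y n) U"
    by (simp add: ultra_class_def ultra_rel_def)
next
  assume e: "eventually (\<lambda>n. x n = y n) U"
  have "eventually (\<lambda>n. x n = z n) U \<longleftrightarrow> eventually (\<lambda>n. y n = z n) U" for z
    using e by (auto elim: eventually_elim2)
  then show "ultra_class U x = ultra_class U y"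
    by (auto simp: ultra_class_def ultra_rel_def)
qed

lemma ultrapower_eq: "ultrapower U = range (ultra_class U)"
  by (auto simp: ultrapower_def quotient_def ultra_class_def)

lemma ultra_class_in_up_set_iff:
  "ultra_class U x \<in> up_set U A \<longleftrightarrow> eventually (\<lambda>n. x n \<in> A n) U"
proof
  assume "ultra_class U x \<in> up_set U A"
  then obtain y where "eventually (\<lambda>n. x n = y n) U" "eventually (\<lambda>n. y n \<in> A n) U"
    by (auto simp: up_set_def ultra_class_eq_iff)
  then show "eventually (\<lambda>n. x n \<in> A n) U"
    by eventually_elim simp
qed (auto simp: up_set_def)

lemma up_set_subset: "up_set U A \<subseteq> ultrapower U"
  by (auto simp: up_set_def ultrapower_eq)

lemma ultrafilter_not:
  "ultrafilter U \<Longrightarrow> eventually (\<lambda>i. \<not> P i) U \<longleftrightarrow> \<not> eventually P U"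
proof -
  assume U: "ultrafilter U"
  have "\<not> (eventually P U \<and> eventually (\<lambda>i. \<not> P i) U)"
  proof
    assume "eventually P U \<and> eventually (\<lambda>i. \<not> P i) U"
    then have "eventually (\<lambda>i. P i \<and> \<not> P i) U"
      by (simp only: eventually_conj)
    then have "eventually (\<lambda>_. False) U" by simp
    with U show False
      by (simp add: ultrafilter_def trivial_limit_def)
  qed
  with U show ?thesis by (auto simp: ultrafilter_def)
qed

lemma up_set_subset_iff:
  assumes U: "ultrafilter U"
  shows "up_set U A \<subseteq> up_set U B \<longleftrightarrow> eventually (\<lambda>n. A n \<subseteq> B n) U"
proof
  assume sub: "up_set U A \<subseteq> up_set U B"
  show "eventually (\<lambda>n. A n \<subseteq> B n) U"
  proof (rule ccontr)
    assume "\<not> eventually (\<lambda>n. A n \<subseteq> B n) U"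
    then have ev: "eventually (\<lambda>n. \<not> A n \<subseteq> B n) U"
      by (simp add: ultrafilter_not[OF U])
    define x where "x = (\<lambda>n. SOME y. y \<in> A n \<and> y \<notin> B n)"
    have x: "\<not> A n \<subseteq> B n \<Longrightarrow> x n \<in> A n \<and> x n \<notin> B n" for n
      unfolding x_def by (rule someI_ex) auto
    have "eventually (\<lambda>n. x n \<in> A n) U"
      using ev by eventually_elim (use x in blast)
    moreover have "eventually (\<lambda>n. \<not> x n \<in> B n) U"
      using ev by eventually_elim (use x in blast)
    ultimately have "ultra_class U x \<in> up_set U A" "ultra_class U x \<notin> up_set U B"
      by (simp_all add: ultra_class_in_up_set_iff ultrafilter_not[OF U])
    then show False
      using sub by blast
  qed
next
  assume sub: "eventually (\<lambda>n. A n \<subseteq> B n) U"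
  show "up_set U A \<subseteq> up_set U B"
  proof
    fix c assume "c \<in> up_set U A"
    then obtain x where c: "c = ultra_class U x" and x: "eventually (\<lambda>n. x n \<in> A n) U"
      by (auto simp: up_set_def)
    from sub x have "eventually (\<lambda>n. x n \<in> B n) U"
      by eventually_elim blast
    then show "c \<in> up_set U B"
      by (simp add: c ultra_class_in_up_set_iff)
  qed
qed

lemma up_set_eq_iff:
  assumes U: "ultrafilter U"
  shows "up_set U A = up_set U B \<longleftrightarrow> eventually (\<lambda>n. A n = B n) U"
  by (simp add: set_eq_subset up_set_subset_iff[OF U] eventually_conj_iff)

lemma ultrafilter_limit_exists:
  fixes f :: "'i \<Rightarrow> 'b::topological_space"
  assumes U: "ultrafilter U" and c: "compact (UNIV :: 'b set)"
  shows "\<exists>l. (f \<longlongrightarrow> l) U"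
proof -
  have "filtermap f U \<noteq> bot"
    using U by (simp add: ultrafilter_def filtermap_bot_iff)
  then obtain l where l: "inf (nhds l) (filtermap f U) \<noteq> bot"
    using c by (auto simp: compact_filter)
  have "(f \<longlongrightarrow> l) U"
  proof (rule topological_tendstoI, rule ccontr)
    fix S assume S: "open S" "l \<in> S" and "\<not> eventually (\<lambda>x. f x \<in> S) U"
    then have "eventually (\<lambda>x. f x \<notin> S) U"
      by (simp add: ultrafilter_not[OF U])
    moreover have "eventually (\<lambda>y. y \<in> S) (nhds l)"
      using S by (auto simp: eventually_nhds)
    ultimately have "eventually (\<lambda>_. False) (inf (nhds l) (filtermap f U))"
      unfolding eventually_inf eventually_filtermap by fastforce
    with l show False by (simp add: trivial_limit_def)
  qed
  then show ?thesis ..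
qed

lemma tendsto_up_premeasure:
  assumes U: "ultrafilter U" and A: "range A \<subseteq> sets M"
  shows "((\<lambda>n. emeasure M (A n)) \<longlongrightarrow> up_premeasure U M (up_set U A)) U"
proof -
  have bot: "U \<noteq> bot" using U by (simp add: ultrafilter_def)
  obtain c where c: "((\<lambda>n. emeasure M (A n)) \<longlongrightarrow> c) U"
    using ultrafilter_limit_exists[OF U, of "\<lambda>n. emeasure M (A n)"]
    by (auto simp: compact_eq_closed)
  have "up_premeasure U M (up_set U A) = c"
    unfolding up_premeasure_def
  proof (rule the_equality)
    show "\<exists>A'. range A' \<subseteq> sets M \<and> up_set U A = up_set U A' \<and>
        ((\<lambda>n. emeasure M (A' n)) \<longlongrightarrow> c) U"
      using A c by blast
  next
    fix d assume "\<exists>A'. range A' \<subseteq> sets M \<and> up_set U A = up_set U A' \<and>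
        ((\<lambda>n. emeasure M (A' n)) \<longlongrightarrow> d) U"
    then obtain A' where e: "eventually (\<lambda>n. A n = A' n) U"
      and d: "((\<lambda>n. emeasure M (A' n)) \<longlongrightarrow> d) U"
      by (auto simp: up_set_eq_iff[OF U])
    have "((\<lambda>n. emeasure M (A n)) \<longlongrightarrow> d) U"
      by (rule Lim_transform_eventually[OF d]) (use e in eventually_elim, simp)
    then show "d = c" using c bot tendsto_unique by blast
  qed
  with c show ?thesis by simp
qed

lemma up_premeasure_up_set:
  assumes U: "ultrafilter U" and A: "range A \<subseteq> sets M"
  shows "up_premeasure U M (up_set U A) = Lim U (\<lambda>n. emeasure M (A n))"
  using tendsto_Lim[OF _ tendsto_up_premeasure[OF U A]] U by (simp add: ultrafilter_def)

lemma up_set_Compl: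
  assumes U: "ultrafilter U"
  shows "up_set U (\<lambda>n. - A n) = ultrapower U - up_set U A"
proof (intro set_eqI)
  fix c
  show "c \<in> up_set U (\<lambda>n. - A n) \<longleftrightarrow> c \<in> ultrapower U - up_set U A"
  proof (cases "c \<in> ultrapower U")
    case True
    then obtain x where "c = ultra_class U x" by (auto simp: ultrapower_eq)
    with True show ?thesis
      by (simp add: ultra_class_in_up_set_iff ultrafilter_not[OF U])
  next
    case False
    then show ?thesis using up_set_subset by blast
  qed
qed

lemma up_set_Int: "up_set U (\<lambda>n. A n \<inter> B n) = up_set U A \<inter> up_set U B"
proof (intro set_eqI iffI)
  fix c assume "c \<in> up_set U A \<inter> up_set U B"
  then obtain x where "c = ultra_class U x" "ultra_class U x \<in> up_set U A \<inter> up_set U B"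
    by (auto simp: up_set_def)
  then show "c \<in> up_set U (\<lambda>n. A n \<inter> B n)"
    by (simp add: ultra_class_in_up_set_iff eventually_conj_iff)
qed (auto simp: up_set_def eventually_conj_iff)

lemma up_set_empty:
  assumes U: "ultrafilter U"
  shows "up_set U (\<lambda>_. {}) = {}"
  using U by (auto simp: up_set_def ultrafilter_def)

lemma algebra_up_algebra:
  assumes U: "ultrafilter U" and sp: "space M = UNIV"
  shows "algebra (ultrapower U) (up_algebra U M)"
proof (rule algebra_iff_Int[THEN iffD2], intro conjI ballI)
  show "up_algebra U M \<subseteq> Pow (ultrapower U)"
    using up_set_subset by (auto simp: up_algebra_def)
  show "{} \<in> up_algebra U M"
    unfolding up_algebra_def using up_set_empty[OF U, symmetric] by blast
next
  fix S assume "S \<in> up_algebra U M"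
  then obtain A where A: "range A \<subseteq> sets M" "S = up_set U A"
    by (auto simp: up_algebra_def)
  have "- A n \<in> sets M" for n
    using sets.compl_sets[of "A n" M] A(1) sp by (auto simp: Compl_eq_Diff_UNIV)
  then have "range (\<lambda>n. - A n) \<subseteq> sets M" by auto
  then show "ultrapower U - S \<in> up_algebra U M"
    unfolding up_algebra_def A(2) up_set_Compl[OF U, symmetric] by blast
next
  fix S S' assume "S \<in> up_algebra U M" "S' \<in> up_algebra U M"
  then obtain A B where "range A \<subseteq> sets M" "range B \<subseteq> sets M" "S = up_set U A" "S' = up_set U B"
    by (auto simp: up_algebra_def)
  moreover from this have "range (\<lambda>n. A n \<inter> B n) \<subseteq> sets M" by auto
  ultimately show "S \<inter> S' \<in> up_algebra U M"
    unfolding up_algebra_def using up_set_Int[of U A B] by blast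
qed

lemma positive_up_premeasure:
  assumes U: "ultrafilter U"
  shows "positive (up_algebra U M) (up_premeasure U M)"
  using up_premeasure_up_set[OF U, of "\<lambda>_. {}" M] U
  by (simp add: positive_def up_set_empty ultrafilter_def tendsto_Lim[OF _ tendsto_const])

lemma increasing_up_premeasure:
  assumes U: "ultrafilter U"
  shows "increasing (up_algebra U M) (up_premeasure U M)"
  unfolding increasing_def
proof (intro ballI impI)
  fix S S' assume "S \<in> up_algebra U M" "S' \<in> up_algebra U M" and sub: "S \<subseteq> S'"
  then obtain A B where A: "range A \<subseteq> sets M" "S = up_set U A"
    and B: "range B \<subseteq> sets M" "S' = up_set U B"
    by (auto simp: up_algebra_def)
  have "eventually (\<lambda>n. A n \<subseteq> B n) U"
    using sub A B by (simp add: up_set_subset_iff[OF U])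
  then have "eventually (\<lambda>n. emeasure M (A n) \<le> emeasure M (B n)) U"
    by eventually_elim (use B(1) in \<open>auto intro: emeasure_mono\<close>)
  then show "up_premeasure U M S \<le> up_premeasure U M S'"
    unfolding A(2) B(2)
    using tendsto_le[OF _ tendsto_up_premeasure[OF U B(1)] tendsto_up_premeasure[OF U A(1)]] U
    by (simp add: ultrafilter_def)
qed

lemma measure_space_up_measure:
  assumes U: "ultrafilter U" and sp: "space M = UNIV"
  shows "measure_space (ultrapower U)
    (lambda_system (ultrapower U) (Pow (ultrapower U)) (up_outer_measure U M))
    (up_outer_measure U M)"
proof -
  interpret algebra "ultrapower U" "up_algebra U M"
    by (rule algebra_up_algebra[OF U sp])
  interpret P: sigma_algebra "ultrapower U" "Pow (ultrapower U)"
    by (rule sigma_algebra_Pow)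
  show ?thesis
    unfolding up_outer_measure_def
    by (rule P.caratheodory_lemma[OF outer_measure_space_outer_measure
          [OF positive_up_premeasure[OF U] increasing_up_premeasure[OF U]]])
qed

lemma space_up_measure: "space (up_measure U M) = ultrapower U"
  by (auto simp: up_measure_def lambda_system_def intro!: space_measure_of)

lemma sets_up_measure:
  assumes U: "ultrafilter U" and sp: "space M = UNIV"
  shows "sets (up_measure U M) =
    lambda_system (ultrapower U) (Pow (ultrapower U)) (up_outer_measure U M)"
proof -
  interpret sigma_algebra "ultrapower U"
    "lambda_system (ultrapower U) (Pow (ultrapower U)) (up_outer_measure U M)"
    using measure_space_up_measure[OF U sp] by (simp add: measure_space_def)
  show ?thesis
    by (simp add: up_measure_def)
qed

lemma emeasure_up_measure:
  assumes U: "ultrafilter U" and sp: "space M = UNIV" and S: "S \<in> sets (up_measure U M)"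
  shows "emeasure (up_measure U M) S = up_outer_measure U M S"
proof -
  let ?L = "lambda_system (ultrapower U) (Pow (ultrapower U)) (up_outer_measure U M)"
  have "sigma_algebra (ultrapower U) ?L" "positive ?L (up_outer_measure U M)"
    "countably_additive ?L (up_outer_measure U M)"
    using measure_space_up_measure[OF U sp] by (auto simp: measure_space_def)
  moreover have "S \<in> ?L"
    using S by (simp add: sets_up_measure[OF U sp])
  ultimately show ?thesis
    unfolding up_measure_def by (rule emeasure_measure_of_sigma)
qed

end

(* The map \<phi>h sends [x\<^sub>n] to the ultralimit of f\<^sub>n (x\<^sub>n), where f\<^sub>n is the n-th Birkhoff average of \<phi>.
   It is bounded, and rounding the f\<^sub>n down to multiples of 1/m approximates it uniformly by simple
   functions over UP-sets; the integral formula is immediate for those and passes to the limit.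
   That UP-sets keep their premeasure under the extension rests on the countable saturation of the
   ultrapower, which turns continuity of the premeasure at the empty set into a triviality. *)
theory Submission
  imports Defs
begin

section \<open>Non-principal ultrafilters and the sequential filter\<close>

lemma ultrafilter_neq_bot: "ultrafilter U \<Longrightarrow> U \<noteq> bot"
  by (simp add: ultrafilter_def)

text \<open>An ultrafilter containing \<open>{i}\<close> is principal at \<open>i\<close>, so
  \<open>U\<close> contains the complement of every point and, by finite intersection, every tail.
  Non-principality is used in this form: what holds along \<open>sequentially\<close> holds along
  \<open>U\<close>.\<close>

lemma nonprincipal_ultrafilter_le_sequentially:
  assumes "nonprincipal_ultrafilter U"
  shows "U \<le> sequentially"
proof -
  have U: "ultrafilter U" and np: "\<And>i. U \<noteq> principal {i}"
    using assms by (auto simp: nonprincipal_ultrafilter_def)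
  have ne: "eventually (\<lambda>n. n \<noteq> i) U" for i
  proof (rule ccontr)
    assume "\<not> eventually (\<lambda>n. n \<noteq> i) U"
    then have i: "eventually (\<lambda>n. n = i) U"
      by (simp add: ultrafilter_not[OF U])
    have "eventually P U \<longleftrightarrow> P i" for P
    proof
      assume "eventually P U"
      then have "eventually (\<lambda>_. P i) U"
        using i by eventually_elim simp
      then show "P i"
        by (simp add: ultrafilter_neq_bot[OF U])
    next
      assume "P i"
      with i show "eventually P U" by (auto elim: eventually_mono)
    qed
    then have "U = principal {i}"
      by (simp add: filter_eq_iff eventually_principal)
    with np show False by blast
  qed
  have "eventually (\<lambda>n. N \<le> n) U" for N
  proof (induction N)
    case (Suc N)
    then show ?case
      using ne[of N] by eventually_elim simp
  qed simp
  then show ?thesis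
    unfolding le_filter_def eventually_sequentially using eventually_mono[of _ U] by blast
qed

section \<open>Countable saturation of the ultrapower\<close>

text \<open>Diagonal argument: \<open>x n\<close> is taken from the intersection of the sets of
  index up to \<open>K n\<close>, the largest depth allowed at \<open>n\<close>. For fixed
  \<open>k\<close>, depth \<open>k\<close> is allowed at \<open>U\<close>-almost all
  \<open>n\<close>, hence \<open>k \<le> K n\<close> there.\<close>

lemma up_set_saturated:
  fixes A :: "nat \<Rightarrow> nat \<Rightarrow> 'a set"
  assumes le: "U \<le> sequentially"
    and ne: "\<And>k. eventually (\<lambda>n. (\<Inter>j\<le>k. A j n) \<noteq> {}) U"
  shows "(\<Inter>k. up_set U (A k)) \<noteq> {}"
proof -
  \<comment> \<open>The bound \<open>k \<le> n\<close> makes the greatest such \<open>k\<close>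
    exist; it excludes no fixed \<open>k\<close>, as \<open>U\<close> contains every tail.\<close>
  define P where "P n k \<longleftrightarrow> k \<le> n \<and> (\<Inter>j\<le>k. A j n) \<noteq> {}" for n k :: nat
  define K where "K n = (GREATEST k. P n k)" for n
  define x where "x n = (SOME y. y \<in> (\<Inter>j\<le>K n. A j n))" for n
  have "eventually (\<lambda>n. x n \<in> A k n) U" for k
  proof -
    have "eventually (\<lambda>n. k \<le> n) U"
      using le eventually_ge_at_top filter_leD by blast
    with ne[of k] have "eventually (\<lambda>n. P n k) U"
      by eventually_elim (auto simp: P_def)
    then show ?thesis
    proof eventually_elim
      fix n assume k: "P n k"
      have bd: "\<And>j. P n j \<Longrightarrow> j \<le> n" by (simp add: P_def)
      have "P n (K n)"
        unfolding K_def using GreatestI_nat[where P="P n", OF k] bd by blast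
      have "k \<le> K n"
        unfolding K_def using Greatest_le_nat[where P="P n", OF k] bd by blast
      from \<open>P n (K n)\<close> have "x n \<in> (\<Inter>j\<le>K n. A j n)"
        unfolding x_def P_def by (intro someI_ex[of "\<lambda>y. y \<in> _"]) blast
      with \<open>k \<le> K n\<close> show "x n \<in> A k n" by blast
    qed
  qed
  then have "ultra_class U x \<in> (\<Inter>k. up_set U (A k))"
    by (simp add: ultra_class_in_up_set_iff)
  then show ?thesis by blast
qed

text \<open>If no \<open>S k\<close> is empty, a point of \<open>S k\<close> lies in all earlier
  \<open>S j\<close>, so the sets representing \<open>S 0\<close> to \<open>S k\<close> have a
  common point at \<open>U\<close>-almost all \<open>n\<close>. Saturation then yields a point of
  every \<open>S k\<close>.\<close>

lemma decseq_up_sets_eventually_empty: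
  assumes U: "nonprincipal_ultrafilter U"
    and S: "range S \<subseteq> up_algebra U M" "decseq S" "(\<Inter>k. S k) = {}"
  shows "eventually (\<lambda>k. S k = {}) sequentially"
proof (rule ccontr)
  assume neg: "\<not> eventually (\<lambda>k. S k = {}) sequentially"
  have uf: "ultrafilter U" using U by (simp add: nonprincipal_ultrafilter_def)
  have S_ne: "S k \<noteq> {}" for k
    using neg S(2) unfolding eventually_sequentially decseq_def by blast
  have "\<forall>k. \<exists>A. S k = up_set U A"
    using S(1) unfolding up_algebra_def by blast
  then obtain A where A: "\<And>k. S k = up_set U (A k)" by metis
  have "eventually (\<lambda>n. (\<Inter>j\<le>k. A j n) \<noteq> {}) U" for k
  proof -
    obtain x where x: "ultra_class U x \<in> S k"
      using S_ne[of k] by (auto simp: A up_set_def)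
    have "eventually (\<lambda>n. x n \<in> A j n) U" if "j \<le> k" for j
      using subsetD[OF decseqD[OF S(2) that] x] by (simp add: A ultra_class_in_up_set_iff)
    then have "eventually (\<lambda>n. \<forall>j\<in>{..k}. x n \<in> A j n) U"
      by (intro eventually_ball_finite) auto
    then show ?thesis by eventually_elim blast
  qed
  from up_set_saturated[OF nonprincipal_ultrafilter_le_sequentially[OF U] this] S(3)
  show False by (simp add: A)
qed

section \<open>The extended measure on UP-sets\<close>

text \<open>Ultrafilters are prime: one that contains a union of two sets contains one of the
  two.\<close>

lemma up_set_Un:
  assumes U: "ultrafilter U"
  shows "up_set U (\<lambda>n. A n \<union> B n) = up_set U A \<union> up_set U B"
proof -
  have "eventually (\<lambda>n. x n \<in> A n \<or> x n \<in> B n) U \<longleftrightarrow>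
      eventually (\<lambda>n. x n \<in> A n) U \<or> eventually (\<lambda>n. x n \<in> B n) U" for x
  proof
    assume AB: "eventually (\<lambda>n. x n \<in> A n \<or> x n \<in> B n) U"
    have "eventually (\<lambda>n. x n \<in> B n) U" if "\<not> eventually (\<lambda>n. x n \<in> A n) U"
    proof -
      from that have "eventually (\<lambda>n. x n \<notin> A n) U"
        by (simp add: ultrafilter_not[OF U])
      with AB show ?thesis by eventually_elim blast
    qed
    then show "eventually (\<lambda>n. x n \<in> A n) U \<or> eventually (\<lambda>n. x n \<in> B n) U" by blast
  qed (auto elim: eventually_mono)
  then show ?thesis
    by (auto simp: up_set_def)
qed

text \<open>Disjointness of the UP-sets makes \<open>A n\<close> and \<open>B n\<close> disjoint at
  \<open>U\<close>-almost all \<open>n\<close>; additivity of \<open>M\<close> at these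
  \<open>n\<close> passes to the ultralimit.\<close>

lemma additive_up_premeasure:
  assumes U: "ultrafilter U"
  shows "additive (up_algebra U M) (up_premeasure U M)"
  unfolding additive_def
proof (intro ballI impI)
  fix S S' assume "S \<in> up_algebra U M" "S' \<in> up_algebra U M" and disj: "S \<inter> S' = {}"
  then obtain A B where A: "range A \<subseteq> sets M" "S = up_set U A"
    and B: "range B \<subseteq> sets M" "S' = up_set U B"
    by (auto simp: up_algebra_def)
  have AB: "range (\<lambda>n. A n \<union> B n) \<subseteq> sets M"
    using A(1) B(1) by blast
  have "up_set U (\<lambda>n. A n \<inter> B n) = up_set U (\<lambda>_. {})"
    using disj by (simp add: up_set_Int up_set_empty[OF U] A B)
  then have "eventually (\<lambda>n. A n \<inter> B n = {}) U"
    by (simp add: up_set_eq_iff[OF U])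
  then have "eventually (\<lambda>n. emeasure M (A n) + emeasure M (B n) = emeasure M (A n \<union> B n)) U"
    by eventually_elim (use A(1) B(1) in \<open>auto intro: plus_emeasure\<close>)
  with tendsto_add[OF tendsto_up_premeasure[OF U A(1)] tendsto_up_premeasure[OF U B(1)]]
  have "((\<lambda>n. emeasure M (A n \<union> B n)) \<longlongrightarrow> up_premeasure U M S + up_premeasure U M S') U"
    unfolding A(2) B(2) by (rule Lim_transform_eventually)
  then show "up_premeasure U M (S \<union> S') = up_premeasure U M S + up_premeasure U M S'"
    using tendsto_unique[OF ultrafilter_neq_bot[OF U] tendsto_up_premeasure[OF U AB]]
    by (simp add: A(2) B(2) up_set_Un[OF U])
qed

lemma up_premeasure_finite:
  assumes U: "ultrafilter U" and M: "finite_measure M" and S: "S \<in> up_algebra U M"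
  shows "up_premeasure U M S \<noteq> \<infinity>"
proof -
  obtain A where A: "range A \<subseteq> sets M" "S = up_set U A"
    using S by (auto simp: up_algebra_def)
  have "up_premeasure U M S \<le> emeasure M (space M)"
    unfolding A(2)
    using ultrafilter_neq_bot[OF U] tendsto_up_premeasure[OF U A(1)]
    by (rule tendsto_upperbound[rotated 2]) (simp add: emeasure_space)
  then show ?thesis
    using finite_measure.emeasure_finite[OF M, of "space M"] by (auto simp: top_unique)
qed

text \<open>For a finite, finitely additive set function, continuity at the empty set gives
  countable additivity. Here the decreasing sequences concerned are empty from some index
  on.\<close>

lemma countably_additive_up_premeasure:
  assumes U: "nonprincipal_ultrafilter U" and M: "finite_measure M" "space M = UNIV"
  shows "countably_additive (up_algebra U M) (up_premeasure U M)"
proof -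
  have uf: "ultrafilter U" using U by (simp add: nonprincipal_ultrafilter_def)
  interpret algebra "ultrapower U" "up_algebra U M"
    by (rule algebra_up_algebra[OF uf M(2)])
  note pos = positive_up_premeasure[OF uf, of M]
  show ?thesis
  proof (rule empty_continuous_imp_countably_additive[OF pos additive_up_premeasure[OF uf]])
    show "\<forall>S\<in>up_algebra U M. up_premeasure U M S \<noteq> \<infinity>"
      using up_premeasure_finite[OF uf M(1)] by blast
    fix S assume "range S \<subseteq> up_algebra U M" "decseq S" "(\<Inter>i. S i) = {}"
    from decseq_up_sets_eventually_empty[OF U this]
    have "eventually (\<lambda>i. up_premeasure U M (S i) = 0) sequentially"
      by eventually_elim (use pos in \<open>simp add: positive_def\<close>)
    then show "(\<lambda>i. up_premeasure U M (S i)) \<longlonglongrightarrow> 0"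
      by (rule tendsto_eventually)
  qed
qed

lemma up_set_in_sets_up_measure:
  assumes U: "ultrafilter U" and M: "space M = UNIV" and A: "\<And>n. A n \<in> sets M"
  shows "up_set U A \<in> sets (up_measure U M)"
proof -
  interpret algebra "ultrapower U" "up_algebra U M"
    by (rule algebra_up_algebra[OF U M])
  have "up_set U A \<in> up_algebra U M"
    using A by (auto simp: up_algebra_def)
  then show ?thesis
    unfolding sets_up_measure[OF U M] up_outer_measure_def
    using algebra_subset_lambda_system[OF positive_up_premeasure[OF U]
        increasing_up_premeasure[OF U] additive_up_premeasure[OF U]] by blast
qed

text \<open>Countable additivity on the algebra makes the outer measure agree with the premeasure
  there, so the extension keeps the ultralimit as its value.\<close>

lemma tendsto_emeasure_up_set:
  assumes U: "nonprincipal_ultrafilter U" and M: "finite_measure M" "space M = UNIV"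
    and A: "\<And>n. A n \<in> sets M"
  shows "((\<lambda>n. emeasure M (A n)) \<longlongrightarrow> emeasure (up_measure U M) (up_set U A)) U"
proof -
  have uf: "ultrafilter U" using U by (simp add: nonprincipal_ultrafilter_def)
  interpret algebra "ultrapower U" "up_algebra U M"
    by (rule algebra_up_algebra[OF uf M(2)])
  have "up_set U A \<in> up_algebra U M"
    using A by (auto simp: up_algebra_def)
  then have "emeasure (up_measure U M) (up_set U A) = up_premeasure U M (up_set U A)"
    using outer_measure_agrees[OF positive_up_premeasure[OF uf]
        countably_additive_up_premeasure[OF U M]]
    by (simp add: emeasure_up_measure[OF uf M(2) up_set_in_sets_up_measure[OF uf M(2) A]]
        up_outer_measure_def)
  then show ?thesis
    using tendsto_up_premeasure[OF uf, of A M] A by auto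
qed

lemma prob_space_up_measure:
  fixes M :: "'a measure"
  assumes U: "nonprincipal_ultrafilter U" and M: "prob_space M" "space M = UNIV"
  shows "prob_space (up_measure U M)"
proof
  have uf: "ultrafilter U" using U by (simp add: nonprincipal_ultrafilter_def)
  \<comment> \<open>The whole space is a UP-set, so its mass is the ultralimit of the constant
    \<open>1\<close>.\<close>
  have "up_set U (\<lambda>_. UNIV :: 'a set) = ultrapower U"
    by (auto simp: up_set_def ultrapower_eq)
  moreover have "UNIV \<in> sets M" using sets.top[of M] M(2) by simp
  ultimately have "((\<lambda>n::nat. emeasure M (space M)) \<longlongrightarrow> emeasure (up_measure U M) (ultrapower U)) U"
    using tendsto_emeasure_up_set[OF U prob_space.finite_measure[OF M(1)] M(2), of "\<lambda>_. UNIV"]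
    by (simp add: M(2))
  then show "emeasure (up_measure U M) (space (up_measure U M)) = 1"
    using tendsto_unique[OF ultrafilter_neq_bot[OF uf] _ tendsto_const]
    by (simp add: space_up_measure prob_space.emeasure_space_1[OF M(1)])
qed

lemma tendsto_measure_up_set:
  assumes U: "nonprincipal_ultrafilter U" and M: "prob_space M" "space M = UNIV"
    and A: "\<And>n. A n \<in> sets M"
  shows "((\<lambda>n. measure M (A n)) \<longlongrightarrow> measure (up_measure U M) (up_set U A)) U"
proof -
  interpret M: prob_space M by fact
  interpret V: prob_space "up_measure U M" by (rule prob_space_up_measure[OF U M])
  show ?thesis
    unfolding measure_def
    using tendsto_emeasure_up_set[OF U M.finite_measure_axioms M(2), of A] A
    by (intro tendsto_enn2real) (simp_all add: V.emeasure_eq_measure)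
qed

section \<open>Ultralimit functions on the ultrapower\<close>

text \<open>The representative is an arbitrary choice; for uniformly bounded \<open>g\<close> the
  value does not depend on it. Where \<open>S\<close> is no class the value is unspecified, but such
  \<open>S\<close> lie outside the space of \<open>up_measure\<close>.\<close>

definition up_fun :: "nat filter \<Rightarrow> (nat \<Rightarrow> 'a \<Rightarrow> real) \<Rightarrow> (nat \<Rightarrow> 'a) set \<Rightarrow> real" where
  "up_fun U g S = Lim U (\<lambda>n. g n ((SOME x. S = ultra_class U x) n))"

text \<open>Compactness of \<open>ereal\<close> provides a limit, and the bounds exclude the
  infinite values.\<close>

lemma ultrafilter_bounded_limit_exists:
  fixes f :: "'i \<Rightarrow> real"
  assumes U: "ultrafilter U" and bd: "\<And>i. \<bar>f i\<bar> \<le> C"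
  shows "\<exists>l. (f \<longlongrightarrow> l) U"
proof -
  obtain l where l: "((\<lambda>i. ereal (f i)) \<longlongrightarrow> l) U"
    using ultrafilter_limit_exists[OF U, of "\<lambda>i. ereal (f i)"] by (auto simp: compact_eq_closed)
  have "l \<le> ereal C"
    using bd by (intro tendsto_upperbound[OF l _ ultrafilter_neq_bot[OF U]]) (auto simp: abs_le_iff)
  moreover have "ereal (- C) \<le> l"
    using bd by (intro tendsto_lowerbound[OF l _ ultrafilter_neq_bot[OF U]]) (auto simp: abs_le_iff minus_le_iff)
  ultimately obtain r where "l = ereal r"
    by (cases l) auto
  with l show ?thesis by auto
qed

text \<open>The given \<open>x\<close> and the representative chosen in \<open>up_fun\<close> agree
  at \<open>U\<close>-almost all \<open>n\<close>, so they have the same ultralimit.\<close>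

lemma tendsto_up_fun:
  assumes U: "ultrafilter U" and bd: "\<And>n x. \<bar>g n x\<bar> \<le> C"
  shows "((\<lambda>n. g n (x n)) \<longlongrightarrow> up_fun U g (ultra_class U x)) U"
proof -
  define y where "y = (SOME y. ultra_class U x = ultra_class U y)"
  have "ultra_class U x = ultra_class U y"
    unfolding y_def by (rule someI[of _ x]) simp
  then have e: "eventually (\<lambda>n. x n = y n) U"
    by (simp add: ultra_class_eq_iff)
  obtain l where l: "((\<lambda>n. g n (y n)) \<longlongrightarrow> l) U"
    using ultrafilter_bounded_limit_exists[OF U, of "\<lambda>n. g n (y n)"] bd by blast
  have "up_fun U g (ultra_class U x) = l"
    using tendsto_Lim[OF ultrafilter_neq_bot[OF U] l] by (simp add: up_fun_def y_def)
  moreover have "((\<lambda>n. g n (x n)) \<longlongrightarrow> l) U"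
    by (rule Lim_transform_eventually[OF l]) (use e in eventually_elim, simp)
  ultimately show ?thesis by simp
qed

lemma abs_up_fun_le:
  assumes U: "ultrafilter U" and bd: "\<And>n x. \<bar>g n x\<bar> \<le> C" and S: "S \<in> ultrapower U"
  shows "\<bar>up_fun U g S\<bar> \<le> C"
proof -
  obtain x where "S = ultra_class U x" using S by (auto simp: ultrapower_eq)
  then show ?thesis
    using tendsto_upperbound[OF tendsto_rabs[OF tendsto_up_fun[OF U bd, where x=x]] _
        ultrafilter_neq_bot[OF U]] bd by simp
qed

section \<open>Approximation by simple functions and the integral\<close>

text \<open>For \<open>m > 0\<close> this is where \<open>g n\<close> takes values in
  \<open>[k/m, (k+1)/m)\<close>. The index \<open>n\<close> comes last so that
  \<open>level g m k\<close> is a sequence of sets, as \<open>up_set\<close> expects.\<close>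

definition level :: "(nat \<Rightarrow> 'a \<Rightarrow> real) \<Rightarrow> real \<Rightarrow> int \<Rightarrow> nat \<Rightarrow> 'a set" where
  "level g m k n = {x. \<lfloor>m * g n x\<rfloor> = k}"

text \<open>At most one term of the sum is nonzero, so the sum is \<open>g n x\<close> rounded down
  to a multiple of \<open>1 / m\<close>.\<close>

lemma floor_approx:
  fixes g :: "nat \<Rightarrow> 'a \<Rightarrow> real"
  assumes m: "0 < m" and bd: "\<bar>g n x\<bar> \<le> C" and N: "m * C + 1 \<le> real_of_int N"
  shows "\<bar>g n x - (\<Sum>k\<in>{-N..N}. of_int k / m * indicator (level g m k n) x)\<bar> \<le> 1 / m"
proof -
  define k0 where "k0 = \<lfloor>m * g n x\<rfloor>"
  have "\<bar>m * g n x\<bar> \<le> m * C" using m bd by (simp add: abs_mult)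
  \<comment> \<open>The \<open>+ 1\<close> in the bound on \<open>N\<close> absorbs the rounding,
    since the floor may fall below \<open>- m * C\<close> by almost \<open>1\<close>.\<close>
  then have "k0 \<in> {-N..N}"
    unfolding k0_def atLeastAtMost_iff using N by linarith
  have "(\<Sum>k\<in>{-N..N}. of_int k / m * indicator (level g m k n) x)
      = (\<Sum>k\<in>{-N..N}. if k = k0 then of_int k / m else 0)"
    by (intro sum.cong) (auto simp: level_def k0_def)
  also have "\<dots> = of_int k0 / m"
    using \<open>k0 \<in> {-N..N}\<close> by simp
  finally have eq: "(\<Sum>k\<in>{-N..N}. of_int k / m * indicator (level g m k n) x) = of_int k0 / m" .
  have "g n x - of_int k0 / m = (m * g n x - of_int k0) / m"
    using m by (simp add: field_simps)
  moreover have "\<bar>m * g n x - of_int k0\<bar> \<le> 1"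
    unfolding k0_def by linarith
  ultimately show ?thesis
    using m unfolding eq by (simp add: divide_right_mono)
qed

text \<open>The range of \<open>k\<close> is the same for all \<open>n\<close>, so the estimate of
  \<open>floor_approx\<close> passes to the ultralimit term by term.\<close>

lemma up_fun_approx:
  assumes U: "ultrafilter U" and bd: "\<And>n x. \<bar>g n x\<bar> \<le> C"
    and m: "0 < m" and N: "m * C + 1 \<le> real_of_int N" and S: "S \<in> ultrapower U"
  shows "\<bar>up_fun U g S - (\<Sum>k\<in>{-N..N}. of_int k / m * indicator (up_set U (level g m k)) S)\<bar> \<le> 1 / m"
proof -
  obtain x where x: "S = ultra_class U x" using S by (auto simp: ultrapower_eq)
  \<comment> \<open>\<open>U\<close> decides whether \<open>x n\<close> lies in the level set, so
    the indicators are constant at \<open>U\<close>-almost all \<open>n\<close>.\<close>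
  have ind: "((\<lambda>n. indicator (level g m k n) (x n) :: real) \<longlongrightarrow> indicator (up_set U (level g m k)) S) U" for k
  proof (rule tendsto_eventually)
    show "\<forall>\<^sub>F n in U. (indicator (level g m k n) (x n) :: real) = indicator (up_set U (level g m k)) S"
    proof (cases "eventually (\<lambda>n. x n \<in> level g m k n) U")
      case True
      then show ?thesis
        by (auto simp: x ultra_class_in_up_set_iff elim: eventually_mono)
    next
      case False
      then have "eventually (\<lambda>n. x n \<notin> level g m k n) U"
        by (simp add: ultrafilter_not[OF U])
      with False show ?thesis
        by (auto simp: x ultra_class_in_up_set_iff elim: eventually_mono)
    qed
  qed
  have "((\<lambda>n. \<bar>g n (x n) - (\<Sum>k\<in>{-N..N}. of_int k / m * indicator (level g m k n) (x n))\<bar>) \<longlongrightarrow>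
      \<bar>up_fun U g S - (\<Sum>k\<in>{-N..N}. of_int k / m * indicator (up_set U (level g m k)) S)\<bar>) U"
    unfolding x
    by (intro tendsto_intros tendsto_up_fun[OF U bd] ind[unfolded x])
  then show ?thesis
    using floor_approx[of m g, OF m bd N]
    by (intro tendsto_upperbound[OF _ _ ultrafilter_neq_bot[OF U]]) auto
qed

text \<open>The rounding error \<open>1 / m\<close> is uniform in \<open>n\<close> and over both
  spaces, so the two kinds of integral can be compared through simple functions on matching level
  sets.\<close>

lemma up_fun_integral:
  fixes g :: "nat \<Rightarrow> 'a \<Rightarrow> real"
  assumes np: "nonprincipal_ultrafilter U" and M: "prob_space M" "space M = UNIV"
    and g: "\<And>n. g n \<in> borel_measurable M" and bd: "\<And>n x. \<bar>g n x\<bar> \<le> C"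
  shows integrable_up_fun: "integrable (up_measure U M) (up_fun U g)"
    and tendsto_integral_up_fun:
      "((\<lambda>n. integral\<^sup>L M (g n)) \<longlongrightarrow> integral\<^sup>L (up_measure U M) (up_fun U g)) U"
proof -
  have U: "ultrafilter U" using np by (simp add: nonprincipal_ultrafilter_def)
  interpret M: prob_space M by fact
  interpret V: prob_space "up_measure U M" by (rule prob_space_up_measure[OF np M])
  define N where "N m = \<lceil>m * C + 1\<rceil>" for m :: real
  have N: "m * C + 1 \<le> real_of_int (N m)" for m
    unfolding N_def by (rule le_of_int_ceiling)
  \<comment> \<open>\<open>s m\<close> on the ultrapower and \<open>t m n\<close> on the original
    space share coefficients and index range; \<open>s m\<close> replaces each sequence of level
    sets by its UP-set.\<close>
  define s where "s m S = (\<Sum>k\<in>{-N m..N m}. of_int k / m * indicator (up_set U (level g m k)) S)"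
    for m :: real and S
  define t where "t m n x = (\<Sum>k\<in>{-N m..N m}. of_int k / m * indicator (level g m k n) x)"
    for m :: real and n x
  have level: "level g m k n \<in> sets M" for m k n
  proof -
    have "(\<lambda>x. \<lfloor>m * g n x\<rfloor>) \<in> measurable M (count_space UNIV)"
      using g[of n] by measurable
    then have "(\<lambda>x. \<lfloor>m * g n x\<rfloor>) -` {k} \<inter> space M \<in> sets M"
      by (rule measurable_sets) simp
    then show ?thesis
      by (simp add: level_def M(2) vimage_def)
  qed
  note [measurable] = level up_set_in_sets_up_measure[OF U M(2) level]
  have s_int: "integrable (up_measure U M) (s m)" for m
    unfolding s_def by (intro Bochner_Integration.integrable_sum integrable_mult_right)
      (simp add: V.emeasure_eq_measure)
  have t_int: "integrable M (t m n)" for m n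
    unfolding t_def by (intro Bochner_Integration.integrable_sum integrable_mult_right)
      (simp add: M.emeasure_eq_measure)
  have g_int: "integrable M (g n)" for n
    by (rule M.integrable_const_bound[of _ C]) (use bd g in auto)
  have s_meas: "s m \<in> borel_measurable (up_measure U M)" for m
    using s_int by (rule borel_measurable_integrable)
  have s_approx: "\<bar>up_fun U g S - s m S\<bar> \<le> 1 / m"
    if "0 < m" "S \<in> space (up_measure U M)" for m S
    unfolding s_def using up_fun_approx[OF U bd that(1) N] that(2) by (simp add: space_up_measure)
  \<comment> \<open>A pointwise limit of the simple functions \<open>s m\<close> along
    \<open>m = i + 1\<close>, which keeps \<open>m\<close> positive.\<close>
  have "up_fun U g \<in> borel_measurable (up_measure U M)"
  proof (rule borel_measurable_LIMSEQ_real)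
    fix S assume S: "S \<in> space (up_measure U M)"
    show "(\<lambda>i. s (real (Suc i)) S) \<longlonglongrightarrow> up_fun U g S"
    proof (rule LIM_zero_cancel, rule Lim_null_comparison)
      show "\<forall>\<^sub>F i in sequentially. norm (s (real (Suc i)) S - up_fun U g S) \<le> 1 / real (Suc i)"
        using s_approx[OF _ S, of "real (Suc _)"] by (simp add: abs_minus_commute)
      show "(\<lambda>i. 1 / real (Suc i)) \<longlonglongrightarrow> 0"
        using LIMSEQ_inverse_real_of_nat by (simp add: inverse_eq_divide)
    qed
  qed (rule s_meas)
  then show int: "integrable (up_measure U M) (up_fun U g)"
    by (intro V.integrable_const_bound[of _ C])
       (auto simp: space_up_measure abs_up_fun_le[OF U bd])
  have s_close: "\<bar>integral\<^sup>L (up_measure U M) (up_fun U g) - integral\<^sup>L (up_measure U M) (s m)\<bar> \<le> 1 / m"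
    if m: "0 < m" for m
  proof -
    have "\<bar>\<integral>S. (up_fun U g S - s m S) \<partial>up_measure U M\<bar> \<le> (\<integral>S. \<bar>up_fun U g S - s m S\<bar> \<partial>up_measure U M)"
      by (rule integral_abs_bound)
    also have "\<dots> \<le> 1 / m"
      using int s_int s_approx[OF m] by (intro V.integral_le_const) auto
    finally show ?thesis using int s_int by simp
  qed
  have t_close: "\<bar>integral\<^sup>L M (g n) - integral\<^sup>L M (t m n)\<bar> \<le> 1 / m" if m: "0 < m" for m n
  proof -
    have "\<bar>\<integral>x. (g n x - t m n x) \<partial>M\<bar> \<le> (\<integral>x. \<bar>g n x - t m n x\<bar> \<partial>M)"
      by (rule integral_abs_bound)
    also have "\<dots> \<le> 1 / m"
      using g_int t_int floor_approx[of m g, OF m bd N, folded t_def]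
      by (intro M.integral_le_const) auto
    finally show ?thesis using g_int t_int by simp
  qed
  \<comment> \<open>Both integrals are the same finite linear combination of measures of level sets
    and of their UP-sets, where the ultralimit is known.\<close>
  have t_lim: "((\<lambda>n. integral\<^sup>L M (t m n)) \<longlongrightarrow> integral\<^sup>L (up_measure U M) (s m)) U" for m
  proof -
    have "integral\<^sup>L M (t m n) = (\<Sum>k\<in>{-N m..N m}. of_int k / m * measure M (level g m k n))" for n
      unfolding t_def
      by (subst Bochner_Integration.integral_sum)
         (auto simp: M(2) M.emeasure_eq_measure intro!: integrable_mult_right)
    moreover have "integral\<^sup>L (up_measure U M) (s m) =
        (\<Sum>k\<in>{-N m..N m}. of_int k / m * measure (up_measure U M) (up_set U (level g m k)))"
      unfolding s_def
      by (subst Bochner_Integration.integral_sum)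
         (auto simp: V.emeasure_eq_measure space_up_measure Int_absorb2[OF up_set_subset]
           intro!: integrable_mult_right)
    ultimately show ?thesis
      by (simp only:) (intro tendsto_intros tendsto_measure_up_set[OF np M level])
  qed
  show "((\<lambda>n. integral\<^sup>L M (g n)) \<longlongrightarrow> integral\<^sup>L (up_measure U M) (up_fun U g)) U"
  proof (rule tendstoI)
    fix e :: real assume e: "0 < e"
    \<comment> \<open>With \<open>3 / e\<close> each of the two rounding errors is at most
      \<open>e / 3\<close>, which leaves \<open>e / 3\<close> for \<open>t_lim\<close>.\<close>
    define m where "m = 3 / e"
    have m: "0 < m" "1 / m = e / 3" using e by (auto simp: m_def)
    have "eventually (\<lambda>n. dist (integral\<^sup>L M (t m n)) (integral\<^sup>L (up_measure U M) (s m)) < e / 3) U"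
      using e by (intro tendstoD[OF t_lim]) simp
    then show "eventually (\<lambda>n. dist (integral\<^sup>L M (g n)) (integral\<^sup>L (up_measure U M) (up_fun U g)) < e) U"
    proof eventually_elim
      case (elim n)
      with s_close[OF m(1)] t_close[OF m(1), of n] show ?case
        unfolding m(2) dist_real_def by linarith
    qed
  qed
qed

section \<open>Birkhoff averages\<close>

text \<open>At \<open>n = 0\<close> the value is \<open>0\<close>, because \<open>1 / 0 = 0\<close>;
  a non-principal \<open>U\<close> ignores this index.\<close>

definition birkhoff_average :: "('a \<Rightarrow> 'a) \<Rightarrow> ('a \<Rightarrow> real) \<Rightarrow> nat \<Rightarrow> 'a \<Rightarrow> real" where
  "birkhoff_average T \<phi> n x = 1 / real n * (\<Sum>j<n. \<phi> ((T ^^ j) x))"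

lemma abs_birkhoff_average_le:
  assumes bd: "\<And>x. \<bar>\<phi> x\<bar> \<le> C"
  shows "\<bar>birkhoff_average T \<phi> n x\<bar> \<le> C"
proof (cases "n = 0")
  \<comment> \<open>The average is \<open>0\<close> here, and \<open>0 \<le> C\<close> follows from
    the bound at \<open>x\<close>.\<close>
  case True
  then show ?thesis
    using bd[of x] by (simp add: birkhoff_average_def)
next
  case False
  have "\<bar>\<Sum>j<n. \<phi> ((T ^^ j) x)\<bar> \<le> (\<Sum>j<n. C)"
    using bd by (intro order_trans[OF sum_abs] sum_mono)
  with False show ?thesis
    by (simp add: birkhoff_average_def abs_mult field_simps)
qed

text \<open>Passing from \<open>x\<close> to \<open>T x\<close> shifts the orbit by one step, so the
  difference of the sums telescopes.\<close>

lemma birkhoff_average_shift: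
  "birkhoff_average T \<phi> n (T x) - birkhoff_average T \<phi> n x = (\<phi> ((T ^^ n) x) - \<phi> x) / real n"
proof -
  have "(\<Sum>j<n. \<phi> ((T ^^ j) (T x))) - (\<Sum>j<n. \<phi> ((T ^^ j) x))
      = (\<Sum>j<n. \<phi> ((T ^^ Suc j) x) - \<phi> ((T ^^ j) x))"
    by (simp add: sum_subtractf funpow_swap1)
  also have "\<dots> = \<phi> ((T ^^ n) x) - \<phi> x"
    using sum_lessThan_telescope[of "\<lambda>j. \<phi> ((T ^^ j) x)" n] by simp
  finally show ?thesis
    by (simp add: birkhoff_average_def flip: diff_divide_distrib)
qed

text \<open>The numerator stays within \<open>2 * C\<close>. This asymptotic invariance becomes
  exact in the ultralimit.\<close>

lemma tendsto_birkhoff_average_shift: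
  assumes bd: "\<And>x. \<bar>\<phi> x\<bar> \<le> C"
  shows "(\<lambda>n. birkhoff_average T \<phi> n (T x) - birkhoff_average T \<phi> n x) \<longlonglongrightarrow> 0"
  unfolding birkhoff_average_shift
proof (rule Lim_null_comparison)
  have "\<bar>\<phi> y - \<phi> x\<bar> \<le> 2 * C" for y
    using bd[of x] bd[of y] by linarith
  then show "\<forall>\<^sub>F n in sequentially. norm ((\<phi> ((T ^^ n) x) - \<phi> x) / real n) \<le> 2 * C / real n"
    by (simp add: divide_right_mono)
  show "(\<lambda>n. 2 * C / real n) \<longlonglongrightarrow> 0"
    by (rule lim_const_over_n)
qed

theorem corollary1:
  fixes \<mu> :: "'a::metric_space measure"
    and U :: "nat filter"
    and T :: "'a \<Rightarrow> 'a"
    and \<phi> :: "'a \<Rightarrow> real"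
  assumes "compact (UNIV :: 'a set)"
    and "prob_space \<mu>"
    and "sets \<mu> = sets borel"
    and "nonprincipal_ultrafilter U"
    and "T \<in> borel_measurable borel"
    and "\<phi> \<in> borel_measurable borel"
    and "bounded (range \<phi>)"
  shows "\<exists>\<phi>h :: (nat \<Rightarrow> 'a) set \<Rightarrow> real.
      integrable (up_measure U \<mu>) \<phi>h \<and>
      (\<forall>x. ((\<lambda>n. 1 / real n * (\<Sum>j<n. \<phi> ((T ^^ j) x))) \<longlongrightarrow> \<phi>h (ultra_incl U x)) U) \<and>
      (\<forall>x. \<phi>h (ultra_incl U (T x)) = \<phi>h (ultra_incl U x)) \<and>
      ((\<lambda>n. 1 / real n * (\<Sum>j<n. integral\<^sup>L \<mu> (\<lambda>x. \<phi> ((T ^^ j) x)))) \<longlongrightarrow>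
        integral\<^sup>L (up_measure U \<mu>) \<phi>h) U"
proof -
  have sp: "space \<mu> = UNIV"
    using sets_eq_imp_space_eq[OF assms(3)] by simp
  have U: "ultrafilter U" using assms(4) by (simp add: nonprincipal_ultrafilter_def)
  interpret prob_space \<mu> by fact
  obtain C where C: "\<And>x. \<bar>\<phi> x\<bar> \<le> C"
    using assms(7) by (auto simp: bounded_iff)
  have T_pow: "T ^^ j \<in> borel_measurable borel" for j
  proof (induction j)
    case (Suc j)
    then show ?case
      using measurable_comp[OF Suc assms(5)] by (simp add: comp_def)
  qed (simp add: id_def)
  have meas: "(\<lambda>x. \<phi> ((T ^^ j) x)) \<in> borel_measurable \<mu>" for j
    using measurable_compose[OF T_pow assms(6)] by (simp add: measurable_cong_sets[OF assms(3) refl])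
  have int: "integrable \<mu> (\<lambda>x. \<phi> ((T ^^ j) x))" for j
    by (rule integrable_const_bound[of _ C]) (use C meas in auto)
  let ?f = "birkhoff_average T \<phi>"
  have f_meas: "?f n \<in> borel_measurable \<mu>" for n
    unfolding birkhoff_average_def using meas by measurable
  note f_bd = abs_birkhoff_average_le[of \<phi>, OF C]
  \<comment> \<open>On the class of a constant sequence, the ultralimit defining
    \<open>up_fun\<close> is that of the averages at the single point \<open>x\<close>.\<close>
  have lim: "((\<lambda>n. ?f n x) \<longlongrightarrow> up_fun U ?f (ultra_incl U x)) U" for x
    unfolding ultra_incl_def by (rule tendsto_up_fun[OF U f_bd])
  have inv: "up_fun U ?f (ultra_incl U (T x)) = up_fun U ?f (ultra_incl U x)" for x
  proof -
    \<comment> \<open>Convergence along \<open>sequentially\<close> carries over to the finer filter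
      \<open>U\<close>; uniqueness of ultralimits then gives the invariance.\<close>
    have "((\<lambda>n. ?f n (T x) - ?f n x) \<longlongrightarrow> 0) U"
      using tendsto_birkhoff_average_shift[OF C] nonprincipal_ultrafilter_le_sequentially[OF assms(4)]
      by (rule tendsto_mono[rotated])
    then show ?thesis
      using tendsto_unique[OF ultrafilter_neq_bot[OF U] tendsto_diff[OF lim[of "T x"] lim[of x]], of 0]
      by simp
  qed
  \<comment> \<open>Linearity turns the average of the integrals into the integral of the average,
    to which \<open>tendsto_integral_up_fun\<close> applies.\<close>
  have "integral\<^sup>L \<mu> (?f n) = 1 / real n * (\<Sum>j<n. integral\<^sup>L \<mu> (\<lambda>x. \<phi> ((T ^^ j) x)))" for n
    unfolding birkhoff_average_def
    by (subst integral_mult_right_zero, subst Bochner_Integration.integral_sum) (auto intro: int)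
  then have "((\<lambda>n. 1 / real n * (\<Sum>j<n. integral\<^sup>L \<mu> (\<lambda>x. \<phi> ((T ^^ j) x)))) \<longlongrightarrow>
      integral\<^sup>L (up_measure U \<mu>) (up_fun U ?f)) U"
    using tendsto_integral_up_fun[OF assms(4) assms(2) sp f_meas f_bd] by simp
  moreover have "((\<lambda>n. 1 / real n * (\<Sum>j<n. \<phi> ((T ^^ j) x))) \<longlongrightarrow> up_fun U ?f (ultra_incl U x)) U" for x
    using lim[of x] by (simp only: birkhoff_average_def[symmetric])
  moreover have "integrable (up_measure U \<mu>) (up_fun U ?f)"
    by (rule integrable_up_fun[OF assms(4) assms(2) sp f_meas f_bd])
  ultimately show ?thesis
    using inv by (intro exI[of _ "up_fun U ?f"] conjI allI)
qed

end
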